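(* The lengths of periodic orbits of convex monotone homogeneous maps $\mathbb{R}^n\to\mathbb{R}^n$ are exactly the orders of the elements of the symmetric group on $n$ letters. That is, for $n\ge1$, an integer $c\ge1$ is the length of a periodic orbit of some convex monotone homogeneous map $f:\mathbb{R}^n\to\mathbb{R}^n$ if, and only if, $c$ is the order of some element of the symmetric group on $n$ letters.
   Context: $\leq$ is the entrywise order of $\mathbb{R}^n$ and $\lambda+x=(\lambda+x_1,\dots,\lambda+x_n)$. A map $f$ is monotone if $x\le y\Rightarrow f(x)\le f(y)$, (additively) homogeneous if $f(\lambda+x)=\lambda+f(x)$ for all $\lambda\in\mathbb{R}$, and convex if each coordinate is convex. A periodic orbit of $f$ is a set $\{f^k(x)\}_{k\in\mathbb{N}}$ with $f^c(x)=x$ for some $c\ge1$; its length is the smallest such $c\ge1$. *)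

theory Defs
  imports "HOL-Analysis.Analysis" "HOL-Algebra.Sym_Groups" "HOL-Algebra.Multiplicative_Group"
begin

text \<open>
  The library order on \<^typ>\<open>real ^ 'n\<close> is the entrywise one, so monotonicity of a map
  is just \<^const>\<open>mono\<close>.  \<^term>\<open>vec l\<close> is the vector all of whose
  entries equal \<^term>\<open>l\<close>.
\<close>

definition additively_homogeneous :: "(real ^ 'n::finite \<Rightarrow> real ^ 'n) \<Rightarrow> bool" where
  "additively_homogeneous f \<longleftrightarrow> (\<forall>(l::real) x. f (vec l + x) = vec l + f x)"

definition convex_map :: "(real ^ 'n::finite \<Rightarrow> real ^ 'n) \<Rightarrow> bool" where
  "convex_map f \<longleftrightarrow> (\<forall>i. convex_on UNIV (\<lambda>x. f x $ i))"

text \<open>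
  The least return time is the same for every point of the orbit, so it is read off at any
  generating point; its existence (the second conjunct) makes the \<open>LEAST\<close> meaningful.
\<close>

definition periodic_orbit_of_length :: "('a \<Rightarrow> 'a) \<Rightarrow> 'a set \<Rightarrow> nat \<Rightarrow> bool" where
  "periodic_orbit_of_length f S c \<longleftrightarrow>
     (\<exists>x. S = {(f ^^ k) x | k. True} \<and>
          (\<exists>d\<ge>1. (f ^^ d) x = x) \<and>
          c = (LEAST d. 1 \<le> d \<and> (f ^^ d) x = x))"

end

theory Submission
  imports Defs
begin

text \<open>
  Let \<open>x\<^sub>k\<close> be a periodic orbit of length \<open>c\<close> and let \<open>P\<^sub>k\<close> be a stochastic matrix of
  subgradients of \<open>f\<close> at \<open>x\<^sub>k\<close>. Then \<open>x\<^sub>k\<^sub>+\<^sub>1\<^sub>+\<^sub>m - x\<^sub>k\<^sub>+\<^sub>1 \<ge> P\<^sub>k (x\<^sub>k\<^sub>+\<^sub>m - x\<^sub>k)\<close>, so that for every \<open>m\<close> the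
  function \<open>(k, i) \<mapsto> (x\<^sub>k\<^sub>+\<^sub>m - x\<^sub>k)\<^sub>i\<close> is superharmonic for the Markov chain on
  \<open>\<int>/c \<times> {1..n}\<close> with transition probabilities \<open>P\<^sub>k(i, j)\<close> from \<open>(k + 1, i)\<close> to \<open>(k, j)\<close>. It is thus
  constant on each recurrent class. Hence the coordinates met by a recurrent class all have
  the same period \<open>p\<close> in time, and a given coordinate is met only at times in one residue class
  modulo \<open>p\<close>; as the class meets all times, it meets at least \<open>p\<close> coordinates. So the distinct
  periods of the recurrent coordinates sum to at most \<open>n\<close>. If \<open>q\<close> is their least common multiple,
  then \<open>x\<^sub>k\<^sub>+\<^sub>q - x\<^sub>k\<close> vanishes on recurrent states, is therefore nonnegative everywhere, and is zero
  because its sum over a period is zero. Thus \<open>c = q\<close>, the order of a product of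
  disjoint cycles having these periods as lengths.
\<close>

section \<open>Periods of sequences\<close>

definition seq_period :: "(nat \<Rightarrow> 'a) \<Rightarrow> nat" where
  "seq_period a = (LEAST q. 1 \<le> q \<and> (\<forall>t. a (t + q) = a t))"

lemma periodic_mult:
  fixes a :: "nat \<Rightarrow> 'a"
  assumes "\<And>t. a (t + c) = a t"
  shows "a (t + c * k) = a t"
proof (induction k)
  case (Suc k)
  have "a (t + c * Suc k) = a ((t + c * k) + c)" by (simp add: algebra_simps)
  then show ?case using assms Suc by simp
qed simp

lemma periodic_mod:
  fixes a :: "nat \<Rightarrow> 'a"
  assumes "\<And>t. a (t + c) = a t"
  shows "a (t mod c + m) = a (t + m)"
  using periodic_mult[of a c "t mod c + m" "t div c", OF assms]
  by (metis add.assoc add.commute mod_mult_div_eq)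

lemma
  fixes a :: "nat \<Rightarrow> 'a"
  assumes "1 \<le> c" "\<And>t. a (t + c) = a t"
  shows seq_period_ge_1: "1 \<le> seq_period a"
    and seq_period_dvd_iff: "seq_period a dvd q \<longleftrightarrow> (\<forall>t. a (t + q) = a t)"
proof -
  let ?P = "\<lambda>q. 1 \<le> q \<and> (\<forall>t. a (t + q) = a t)"
  have P: "?P (seq_period a)"
    unfolding seq_period_def by (rule LeastI[of ?P c]) (use assms in auto)
  then show "1 \<le> seq_period a" by simp
  have per: "\<And>t. a (t + seq_period a) = a t" using P by blast
  show "seq_period a dvd q \<longleftrightarrow> (\<forall>t. a (t + q) = a t)"
  proof
    assume "seq_period a dvd q"
    then show "\<forall>t. a (t + q) = a t" using periodic_mult[of a, OF per] by (auto elim!: dvdE)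
  next
    assume q: "\<forall>t. a (t + q) = a t"
    have "a (t + q mod seq_period a) = a t" for t
      using periodic_mod[of a "seq_period a" q t, OF per] q by (metis add.commute)
    moreover have "q mod seq_period a < seq_period a" using P by simp
    ultimately have "\<not> 1 \<le> q mod seq_period a"
      using not_less_Least[of "q mod seq_period a" ?P] by (auto simp: seq_period_def)
    then show "seq_period a dvd q" by (simp add: dvd_eq_mod_eq_0)
  qed
qed

text \<open>After \<open>c\<close> shifts by \<open>e\<close> the total drift is \<open>c\<close>
  times \<open>K\<close>, yet a shift by \<open>e * c\<close> is a multiple of the period.\<close>

lemma bounded_drift_eq_0:
  fixes a :: "nat \<Rightarrow> real"
  assumes "1 \<le> c" "\<And>t. a (t + c) = a t" "\<And>t. s \<le> t \<Longrightarrow> a (t + e) = a t + K"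
  shows "K = 0"
proof -
  have "a (s + e * k) = a s + real k * K" for k
  proof (induction k)
    case (Suc k)
    have "a (s + e * Suc k) = a (s + e * k) + K"
      using assms(3)[of "s + e * k"] by (simp add: algebra_simps)
    then show ?case using Suc by (simp add: algebra_simps)
  qed simp
  from this[of c] show ?thesis
    using periodic_mult[of a c s e, OF assms(2)] assms(1) by (simp add: mult.commute)
qed

section \<open>Recurrent states\<close>

lemma min_on_reachable:
  fixes d :: "'s \<Rightarrow> real"
  assumes "finite (E\<^sup>* `` {s})"
  obtains u where "(s, u) \<in> E\<^sup>*" "\<And>v. (s, v) \<in> E\<^sup>* \<Longrightarrow> d u \<le> d v"
proof -
  have "E\<^sup>* `` {s} \<noteq> {}" by auto
  with assms obtain u where "is_arg_min d (\<lambda>v. v \<in> E\<^sup>* `` {s}) u"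
    using ex_is_arg_min_if_finite by blast
  then show thesis using that[of u] by (simp add: is_arg_min_linorder)
qed

text \<open>Minimum principle: by \<open>loc\<close>, a state attaining the minimum passes its value
  on to every successor, so the value travels along paths.\<close>

lemma const_on_reachable_if_min:
  fixes d :: "'s \<Rightarrow> real"
  assumes loc: "\<And>s. (\<And>t. (s, t) \<in> E \<Longrightarrow> d s \<le> d t) \<Longrightarrow> (\<And>t. (s, t) \<in> E \<Longrightarrow> d t = d s)"
    and min: "\<And>t. (s, t) \<in> E\<^sup>* \<Longrightarrow> d s \<le> d t" and "(s, t) \<in> E\<^sup>*"
  shows "d t = d s"
  using assms(3)
proof induction
  case (step y z)
  have "d y \<le> d z'" if "(y, z') \<in> E" for z'
    using min[of z'] step that by (metis rtrancl.rtrancl_into_rtrancl)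
  from loc[OF this step.hyps(2)] step.IH show ?case by simp
qed simp

text \<open>For finite chains this is probabilistic recurrence, expressed through the support of the
  transition matrix alone.\<close>

definition recurrent :: "('s \<times> 's) set \<Rightarrow> 's \<Rightarrow> bool" where
  "recurrent E s \<longleftrightarrow> (\<forall>t. (s, t) \<in> E\<^sup>* \<longrightarrow> (t, s) \<in> E\<^sup>*)"

lemma recurrent_reachable:
  assumes "recurrent E s" "(s, t) \<in> E\<^sup>*"
  shows "recurrent E t"
  using assms unfolding recurrent_def by (meson rtrancl_trans)

text \<open>A reachable state whose own reachable set is smallest is recurrent: whatever it leads to
  has the same reachable set, hence leads back to it.\<close>

lemma reaches_recurrent:
  assumes "finite (E\<^sup>* `` {s})"
  obtains t where "(s, t) \<in> E\<^sup>*" "recurrent E t"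
proof -
  obtain t where t: "(s, t) \<in> E\<^sup>*"
    and min: "\<And>u. (s, u) \<in> E\<^sup>* \<Longrightarrow> card (E\<^sup>* `` {t}) \<le> card (E\<^sup>* `` {u})"
    using ex_has_least_nat[of "\<lambda>t. (s, t) \<in> E\<^sup>*" s "\<lambda>t. card (E\<^sup>* `` {t})"] by auto
  have "(u, t) \<in> E\<^sup>*" if u: "(t, u) \<in> E\<^sup>*" for u
  proof -
    have sub: "E\<^sup>* `` {u} \<subseteq> E\<^sup>* `` {t}" using u by (auto intro: rtrancl_trans)
    have "finite (E\<^sup>* `` {t})"
      by (rule finite_subset[OF _ assms]) (use t in \<open>auto intro: rtrancl_trans\<close>)
    then have "E\<^sup>* `` {u} = E\<^sup>* `` {t}"
      using sub min[of u] t u card_seteq by (metis rtrancl_trans)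
    then show ?thesis by auto
  qed
  then show thesis using that t unfolding recurrent_def by blast
qed

text \<open>The minimum over the class is attained at some \<open>u\<close>; by recurrence
  \<open>u\<close> leads back to \<open>s\<close>, and so to the whole class.\<close>

lemma const_on_recurrent_class:
  fixes d :: "'s \<Rightarrow> real"
  assumes loc: "\<And>s. (\<And>t. (s, t) \<in> E \<Longrightarrow> d s \<le> d t) \<Longrightarrow> (\<And>t. (s, t) \<in> E \<Longrightarrow> d t = d s)"
    and fin: "finite (E\<^sup>* `` {s})" and rec: "recurrent E s" and st: "(s, t) \<in> E\<^sup>*"
  shows "d t = d s"
proof -
  obtain u where u: "(s, u) \<in> E\<^sup>*" and min: "\<And>v. (s, v) \<in> E\<^sup>* \<Longrightarrow> d u \<le> d v"
    using min_on_reachable[OF fin] by blast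
  have us: "(u, s) \<in> E\<^sup>*" using rec u by (auto simp: recurrent_def)
  have "\<And>v. (u, v) \<in> E\<^sup>* \<Longrightarrow> d u \<le> d v" using min u by (meson rtrancl_trans)
  note const = const_on_reachable_if_min[of E d u, OF loc this]
  from const[of s] const[of t] us st show ?thesis by (metis rtrancl_trans)
qed

text \<open>A minimizing state leads to a recurrent one, where the minimal value is still taken and
  is zero.\<close>

lemma nonneg_if_zero_on_recurrent:
  fixes d :: "'s \<Rightarrow> real"
  assumes loc: "\<And>s. (\<And>t. (s, t) \<in> E \<Longrightarrow> d s \<le> d t) \<Longrightarrow> (\<And>t. (s, t) \<in> E \<Longrightarrow> d t = d s)"
    and fin: "finite (E\<^sup>* `` {s})"
    and zero: "\<And>t. (s, t) \<in> E\<^sup>* \<Longrightarrow> recurrent E t \<Longrightarrow> d t = 0"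
  shows "0 \<le> d s"
proof -
  obtain u where u: "(s, u) \<in> E\<^sup>*" and min: "\<And>v. (s, v) \<in> E\<^sup>* \<Longrightarrow> d u \<le> d v"
    using min_on_reachable[OF fin] by blast
  have minu: "\<And>v. (u, v) \<in> E\<^sup>* \<Longrightarrow> d u \<le> d v" using min u by (meson rtrancl_trans)
  have "finite (E\<^sup>* `` {u})"
    by (rule finite_subset[OF _ fin]) (use u in \<open>auto intro: rtrancl_trans\<close>)
  then obtain v where v: "(u, v) \<in> E\<^sup>*" "recurrent E v" by (rule reaches_recurrent)
  have "d v = d u" using const_on_reachable_if_min[of E d u v, OF loc minu] v by blast
  moreover have "d v = 0" using zero u v by (meson rtrancl_trans)
  ultimately show ?thesis using min[of s] by auto
qed

section \<open>Periodic orbits with superharmonic increments\<close>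

text \<open>
  \<open>R k i j\<close> says that the subgradient of the \<open>i\<close>-th coordinate at \<open>x\<^sub>k\<close> has a positive \<open>j\<close>-th entry. The
  assumption \<open>local_min\<close> is all that is needed from superharmonicity.
\<close>

locale superharmonic_orbit =
  fixes X :: "nat \<Rightarrow> 'n::finite \<Rightarrow> real" and c :: nat and R :: "nat \<Rightarrow> 'n \<Rightarrow> 'n \<Rightarrow> bool"
  assumes c_ge_1: "1 \<le> c"
    and periodic: "\<And>t. X (t + c) = X t"
    and successor: "\<And>k i. \<exists>j. R k i j"
    and local_min: "\<And>k m i j. (\<And>j. R k i j \<Longrightarrow> X (Suc k + m) i - X (Suc k) i \<le> X (k + m) j - X k j)
      \<Longrightarrow> R k i j \<Longrightarrow> X (k + m) j - X k j = X (Suc k + m) i - X (Suc k) i"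
begin

definition incr :: "nat \<Rightarrow> nat \<times> 'n \<Rightarrow> real" where
  "incr m s = X (fst s + m) (snd s) - X (fst s) (snd s)"

text \<open>The chain runs backwards in time, since a subgradient at time \<open>l\<close> bounds
  increments at time \<open>l + 1\<close> by those at time \<open>l\<close>. Reducing times modulo
  \<open>c\<close> leaves finitely many reachable states.\<close>

definition step_rel :: "((nat \<times> 'n) \<times> (nat \<times> 'n)) set" where
  "step_rel = {((k, i), (l, j)) | k i l j. l < c \<and> k = Suc l mod c \<and> R l i j}"

definition coord_period :: "'n \<Rightarrow> nat" where
  "coord_period i = seq_period (\<lambda>t. X t i)"

text \<open>Each period occurs once, so that distinct members have disjoint level sets of
  \<open>coord_period\<close>.\<close>

definition recurrent_periods :: "nat set" where
  "recurrent_periods = {coord_period i | k i. k < c \<and> recurrent step_rel (k, i)}"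

lemma coord_periodic: "X (t + c) i = X t i"
  by (simp add: periodic)

lemmas coord_period_ge_1 =
  seq_period_ge_1[OF c_ge_1, of "\<lambda>t. X t i" for i, OF coord_periodic, folded coord_period_def]

lemmas coord_period_dvd_iff =
  seq_period_dvd_iff[OF c_ge_1, of "\<lambda>t. X t i" for i, OF coord_periodic, folded coord_period_def]

lemma incr_local_min:
  assumes "\<And>t. (s, t) \<in> step_rel \<Longrightarrow> incr m s \<le> incr m t" and "(s, t) \<in> step_rel"
  shows "incr m t = incr m s"
proof -
  obtain i l j where st: "s = (Suc l mod c, i)" "t = (l, j)" "l < c" "R l i j"
    using assms(2) by (auto simp: step_rel_def)
  have s: "incr m s = X (Suc l + m) i - X (Suc l) i"
    using periodic_mod[of X c "Suc l" m, OF periodic] periodic_mod[of X c "Suc l" 0, OF periodic]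
    by (simp add: incr_def st)
  have "X (Suc l + m) i - X (Suc l) i \<le> X (l + m) j' - X l j'" if "R l i j'" for j'
    using assms(1)[of "(l, j')"] that st s by (auto simp: step_rel_def incr_def)
  from local_min[OF this st(4)] show ?thesis by (simp add: s) (simp add: st incr_def)
qed

lemma reachable_states: "(s, t) \<in> step_rel\<^sup>* \<Longrightarrow> t = s \<or> t \<in> {..<c} \<times> UNIV"
  by (induction rule: rtrancl_induct) (auto simp: step_rel_def)

lemma finite_reachable: "finite (step_rel\<^sup>* `` {s})"
  by (rule finite_subset[of _ "insert s ({..<c} \<times> UNIV)"]) (use reachable_states in auto)

lemma incr_eq_on_recurrent_class:
  assumes "recurrent step_rel s" "(s, t) \<in> step_rel\<^sup>*"
  shows "incr m t = incr m s"
  by (rule const_on_recurrent_class[OF incr_local_min finite_reachable assms])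

lemma reaches_all_times:
  assumes "k < c" "l < c"
  shows "\<exists>j. ((k, i), (l, j)) \<in> step_rel\<^sup>*"
proof -
  let ?L = "\<lambda>l. \<exists>j. ((k, i), (l, j)) \<in> step_rel\<^sup>*"
  have prev: "?L l" if L: "?L (Suc l mod c)" and "l < c" for l
  proof -
    obtain j where j: "((k, i), (Suc l mod c, j)) \<in> step_rel\<^sup>*" using L by blast
    obtain j' where "R l j j'" using successor by blast
    then have "((Suc l mod c, j), (l, j')) \<in> step_rel" using that by (auto simp: step_rel_def)
    with j show ?thesis by (meson rtrancl.rtrancl_into_rtrancl)
  qed
  have down: "?L a" if "a \<le> b" "b < c" "?L b" for a b
    using that(1)
  proof (induction rule: inc_induct)
    case (step n)
    then have "Suc n mod c = Suc n" using that by simp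
    then show ?case using step.IH step.hyps \<open>b < c\<close> prev[of n] by simp
  qed (use that in simp)
  have "?L 0" using down[of 0 k] assms by blast
  \<comment> \<open>The step back from time 0 wraps around to \<open>c - 1\<close>, from which every
    time can be reached by descending.\<close>
  then have "?L (c - 1)" using prev[of "c - 1"] c_ge_1 by simp
  then show ?thesis using down[of l "c - 1"] assms by simp
qed

text \<open>Equal increments for all \<open>m\<close> make the two coordinate sequences, started at
  times \<open>k\<close> and \<open>l\<close>, differ by a constant.\<close>

lemma coord_period_dvd_if_same_class:
  assumes rec: "recurrent step_rel (k, i)" and reach: "((k, i), (l, j)) \<in> step_rel\<^sup>*"
  shows "coord_period j dvd coord_period i"
proof -
  have eq: "X (l + m) j - X l j = X (k + m) i - X k i" for m
    using incr_eq_on_recurrent_class[OF rec reach, of m] by (simp add: incr_def)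
  let ?q = "coord_period i"
  have i: "X (t + ?q) i = X t i" for t
    using coord_period_dvd_iff[of i ?q] by simp
  have tail: "X (l + m + ?q) j = X (l + m) j" for m
    using eq[of "m + ?q"] eq[of m] i[of "k + m"] by (simp add: add.assoc)
  have "X (t + ?q) j = X t j" for t
  proof -
    \<comment> \<open>Adding \<open>l\<close> full periods moves \<open>t\<close> past
      \<open>l\<close>, into the range covered by \<open>tail\<close>.\<close>
    have "l \<le> t + c * l" using c_ge_1 by (simp add: trans_le_add2)
    then obtain m where m: "t + c * l = l + m" using le_iff_add by blast
    have "X (t + ?q) j = X (t + ?q + c * l) j" by (simp add: periodic_mult[of X, OF periodic])
    also have "\<dots> = X (l + m + ?q) j" using m by (metis add.commute add.left_commute)
    also have "\<dots> = X (t + c * l) j" by (simp only: tail m)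
    also have "\<dots> = X t j" by (simp add: periodic_mult[of X, OF periodic])
    finally show ?thesis .
  qed
  then show ?thesis by (simp add: coord_period_dvd_iff)
qed

lemma coord_period_eq_if_same_class:
  assumes "recurrent step_rel (k, i)" "((k, i), (l, j)) \<in> step_rel\<^sup>*"
  shows "coord_period j = coord_period i"
  using assms coord_period_dvd_if_same_class[of k i l j] coord_period_dvd_if_same_class[of l j k i]
    recurrent_reachable[OF assms] by (auto simp: recurrent_def intro: dvd_antisym)

text \<open>Two visits to the same coordinate, \<open>e\<close> apart, make its sequence repeat
  after \<open>e\<close> up to a constant drift; periodicity excludes a nonzero drift.\<close>

lemma visit_times_congruent:
  assumes rec: "recurrent step_rel (k, i)"
    and l: "((k, i), (l, j)) \<in> step_rel\<^sup>*" "((k, i), (l + e, j)) \<in> step_rel\<^sup>*"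
  shows "coord_period j dvd e"
proof -
  have eq: "X (l + e + m) j - X (l + e) j = X (l + m) j - X l j" for m
    using incr_eq_on_recurrent_class[OF rec l(1), of m] incr_eq_on_recurrent_class[OF rec l(2), of m]
    by (simp add: incr_def)
  define K where "K = X (l + e) j - X l j"
  have shift: "X (t + e) j = X t j + K" if "l \<le> t" for t
    using eq[of "t - l"] that by (simp add: K_def algebra_simps)
  have "K = 0" by (rule bounded_drift_eq_0[OF c_ge_1, of "\<lambda>t. X t j", OF coord_periodic shift])
  have "X (t + e) j = X t j" for t
  proof -
    have "l \<le> t + c * l" using c_ge_1 by (simp add: trans_le_add2)
    from shift[OF this] \<open>K = 0\<close> show ?thesis
      using periodic_mult[of X c "t + e" l, OF periodic] periodic_mult[of X c t l, OF periodic]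
      by (simp add: add.assoc add.commute add.left_commute)
  qed
  then show ?thesis by (simp add: coord_period_dvd_iff)
qed

text \<open>One recurrent class supplies a coordinate \<open>J l\<close> of period \<open>p\<close>
  for each time \<open>l < p\<close>. These are distinct, as visits to one coordinate are congruent
  modulo \<open>p\<close>.\<close>

lemma recurrent_period_le_card:
  assumes "p \<in> recurrent_periods"
  shows "1 \<le> p \<and> p \<le> card {i. coord_period i = p}"
proof
  obtain k i where ki: "k < c" "recurrent step_rel (k, i)" and p: "p = coord_period i"
    using assms by (auto simp: recurrent_periods_def)
  show "1 \<le> p" unfolding p by (rule coord_period_ge_1)
  have "p dvd c" by (simp add: p coord_period_dvd_iff coord_periodic)
  then have "p \<le> c" using c_ge_1 by (simp add: dvd_imp_le)
  have "\<forall>l. \<exists>j. l < p \<longrightarrow> ((k, i), (l, j)) \<in> step_rel\<^sup>*"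
    using reaches_all_times[OF ki(1)] \<open>p \<le> c\<close> by (meson order_less_le_trans)
  then obtain J where J: "\<And>l. l < p \<Longrightarrow> ((k, i), (l, J l)) \<in> step_rel\<^sup>*" by metis
  have per: "coord_period (J l) = p" if "l < p" for l
    using coord_period_eq_if_same_class[OF ki(2) J[OF that]] p by simp
  have "inj_on J {..<p}"
  proof (rule linorder_inj_onI)
    fix l l' assume l: "l < l'" "l \<in> {..<p}" "l' \<in> {..<p}"
    show "J l \<noteq> J l'"
    proof
      assume eq: "J l = J l'"
      have "coord_period (J l) dvd (l' - l)"
        by (rule visit_times_congruent[OF ki(2)]) (use J[of l] J[of l'] eq l in auto)
      then have "p \<le> l' - l" using per[of l] l by (simp add: dvd_imp_le)
      then show False using l by auto
    qed
  qed auto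
  moreover have "J ` {..<p} \<subseteq> {i. coord_period i = p}" using per by auto
  ultimately show "p \<le> card {i. coord_period i = p}"
    using card_inj_on_le[of J "{..<p}" "{i. coord_period i = p}"] by simp
qed

lemma finite_recurrent_periods: "finite recurrent_periods"
  by (rule finite_subset[of _ "range coord_period"]) (auto simp: recurrent_periods_def)

lemma seq_period_eq_Lcm: "seq_period X = Lcm recurrent_periods"
proof (rule dvd_antisym)
  let ?q = "Lcm recurrent_periods"
  have zero: "incr ?q (k, i) = 0" if "k < c" "recurrent step_rel (k, i)" for k i
  proof -
    have "coord_period i dvd ?q" using that by (intro dvd_Lcm) (auto simp: recurrent_periods_def)
    then show ?thesis by (simp add: coord_period_dvd_iff incr_def)
  qed
  have nonneg: "0 \<le> incr ?q (k, i)" if "k < c" for k i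
  proof (rule nonneg_if_zero_on_recurrent[OF incr_local_min finite_reachable])
    fix t assume t: "((k, i), t) \<in> step_rel\<^sup>*" "recurrent step_rel t"
    then have "fst t < c" using reachable_states[OF t(1)] that by auto
    then show "incr ?q t = 0" using zero[of "fst t" "snd t"] t by simp
  qed
  have mono: "X t i \<le> X (t + ?q) i" for t i
    using nonneg[of "t mod c" i] c_ge_1
      periodic_mod[of X c t ?q, OF periodic] periodic_mod[of X c t 0, OF periodic]
    by (simp add: incr_def)
  have "X (t + ?q) i = X t i" for t i
  proof (rule antisym[OF _ mono])
    \<comment> \<open>Since \<open>c\<close> steps of length \<open>?q\<close> lead back to the
      starting value, the nondecreasing chain closes up and is constant.\<close>
    have "X (t + ?q) i \<le> X (t + ?q + ?q * k) i" for k
    proof (induction k)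
      case (Suc k)
      then show ?case using mono[of "t + ?q + ?q * k" i] by (simp add: algebra_simps)
    qed simp
    from this[of "c - 1"] have "X (t + ?q) i \<le> X (t + c * ?q) i"
      using c_ge_1 by (cases c) (auto simp: algebra_simps)
    then show "X (t + ?q) i \<le> X t i" by (simp add: periodic_mult[of X, OF periodic])
  qed
  then show "seq_period X dvd ?q"
    by (subst seq_period_dvd_iff[OF c_ge_1, of X, OF periodic]) (auto simp: fun_eq_iff)
  have "X (t + seq_period X) = X t" for t
    using seq_period_dvd_iff[OF c_ge_1, of X "seq_period X", OF periodic] by simp
  then show "?q dvd seq_period X"
    by (auto intro!: Lcm_least simp: recurrent_periods_def coord_period_dvd_iff)
qed

end

section \<open>Subgradients\<close>

text \<open>A hyperplane separating the graph point at \<open>x\<close> from the strict epigraph is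
  not vertical; its slope is the subgradient.\<close>

lemma convex_on_UNIV_subgradient:
  fixes g :: "'a::euclidean_space \<Rightarrow> real"
  assumes "convex_on UNIV g"
  obtains a where "\<And>y. g x + a \<bullet> (y - x) \<le> g y"
proof -
  \<comment> \<open>The strict inequality keeps \<open>(x, g x)\<close> outside \<open>S\<close>;
    the price is the slack \<open>e\<close> at the end.\<close>
  define S where "S = {z::'a \<times> real. g (fst z) < snd z}"
  have "convex S"
  proof (rule convexI)
    fix z w :: "'a \<times> real" and u v :: real
    assume *: "z \<in> S" "w \<in> S" "0 \<le> u" "0 \<le> v" "u + v = 1"
    have "g (u *\<^sub>R fst z + v *\<^sub>R fst w) \<le> u * g (fst z) + v * g (fst w)"
      using assms * unfolding convex_on_def by auto
    also have "\<dots> < u * snd z + v * snd w"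
    proof (cases "u = 0")
      case False
      then have "u * g (fst z) < u * snd z" "v * g (fst w) \<le> v * snd w"
        using * by (auto simp: S_def intro: mult_left_mono)
      then show ?thesis by simp
    qed (use * in \<open>auto simp: S_def\<close>)
    finally show "u *\<^sub>R z + v *\<^sub>R w \<in> S" by (simp add: S_def)
  qed
  moreover have "(x, g x + 1) \<in> S" "(x, g x) \<notin> S" by (auto simp: S_def)
  ultimately obtain ab \<beta> where ab: "ab \<noteq> 0" and le: "ab \<bullet> (x, g x) \<le> \<beta>" and ge: "\<And>z. z \<in> S \<Longrightarrow> \<beta> \<le> ab \<bullet> z"
    using separating_hyperplane_sets[of "{(x, g x)}" S] by force
  obtain a b where ab_eq: "ab = (a, b)" by (cases ab)
  have sep: "a \<bullet> x + b * g x \<le> a \<bullet> y + b * t" if "g y < t" for y t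
    using le ge[of "(y, t)"] that by (simp add: ab_eq S_def inner_Pair)
  have "0 \<le> b" using sep[of x "g x + 1"] by (simp add: algebra_simps)
  moreover have "b \<noteq> 0"
  proof
    assume "b = 0"
    \<comment> \<open>A vertical hyperplane would bound the linear form \<open>a\<close> below on
      the whole space; moving in direction \<open>- a\<close> refutes this.\<close>
    then have "a \<bullet> x \<le> a \<bullet> (x - a)" using sep[of "x - a" "g (x - a) + 1"] by simp
    then have "a \<bullet> a \<le> 0" by (simp add: inner_diff_right)
    then have "a = 0" using inner_gt_zero_iff[of a] by (metis not_less)
    then show False using ab ab_eq \<open>b = 0\<close> by (simp add: zero_prod_def)
  qed
  ultimately have "0 < b" by simp
  have "g x + (- a /\<^sub>R b) \<bullet> (y - x) \<le> g y" for y
  proof (rule field_le_epsilon)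
    fix e :: real assume "0 < e"
    then have "a \<bullet> x + b * g x \<le> a \<bullet> y + b * (g y + e)" by (intro sep) simp
    then show "g x + (- a /\<^sub>R b) \<bullet> (y - x) \<le> g y + e"
      using \<open>0 < b\<close> by (simp add: inner_diff_right field_simps)
  qed
  then show thesis by (rule that)
qed

text \<open>Testing a subgradient at \<open>x - axis j 1\<close> gives nonnegative entries by
  monotonicity; testing at \<open>vec l + x\<close> with \<open>l\<close> equal to 1 and -1 gives
  sum 1 by homogeneity.\<close>

lemma stochastic_subgradient:
  fixes f :: "real ^ 'n::finite \<Rightarrow> real ^ 'n"
  assumes "convex_map f" "mono f" "additively_homogeneous f"
  shows "\<exists>a :: real ^ 'n. (\<forall>j. 0 \<le> a $ j) \<and> (\<Sum>j\<in>UNIV. a $ j) = 1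
    \<and> (\<forall>y. f x $ i + (\<Sum>j\<in>UNIV. a $ j * (y $ j - x $ j)) \<le> f y $ i)"
proof -
  have "convex_on UNIV (\<lambda>x. f x $ i)" using assms(1) by (simp add: convex_map_def)
  then obtain a where a: "\<And>y. f x $ i + a \<bullet> (y - x) \<le> f y $ i"
    using convex_on_UNIV_subgradient[of "\<lambda>x. f x $ i" x] by blast
  have "0 \<le> a $ j" for j
  proof -
    have "x - axis j 1 \<le> x" by (auto simp: less_eq_vec_def axis_def)
    then have "f (x - axis j 1) $ i \<le> f x $ i"
      using monoD[OF assms(2)] by (simp add: less_eq_vec_def)
    then show ?thesis using a[of "x - axis j 1"] by (simp add: inner_axis inner_minus_right)
  qed
  moreover have "(\<Sum>j\<in>UNIV. a $ j) = 1"
  proof -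
    have "a \<bullet> vec l = l * (\<Sum>j\<in>UNIV. a $ j)" for l
      by (simp add: inner_vec_def sum_distrib_left mult.commute)
    then have shift: "l * (\<Sum>j\<in>UNIV. a $ j) \<le> l" for l
      using a[of "vec l + x"] assms(3) by (simp add: additively_homogeneous_def)
    show ?thesis using shift[of 1] shift[of "-1"] by simp
  qed
  ultimately show ?thesis using a by (auto simp: inner_vec_def)
qed

section \<open>Lengths of orbits are least common multiples of periods\<close>

text \<open>The terms \<open>w j * (v j - u)\<close> are nonnegative with sum at most 0, so all of
  them vanish.\<close>

lemma convex_combination_local_min:
  fixes w :: "'n::finite \<Rightarrow> real"
  assumes "\<And>j. 0 \<le> w j" "sum w UNIV = 1" and sup: "(\<Sum>j\<in>UNIV. w j * v j) \<le> u"
    and min: "\<And>j. 0 < w j \<Longrightarrow> u \<le> v j" and j: "0 < w j"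
  shows "v j = u"
proof -
  have nonneg: "0 \<le> w j * (v j - u)" for j
    using assms(1)[of j] min[of j] by (cases "w j = 0") (auto simp: less_le)
  have "(\<Sum>j\<in>UNIV. w j * (v j - u)) = (\<Sum>j\<in>UNIV. w j * v j) - u"
    using assms(2) by (simp add: right_diff_distrib sum_subtractf flip: sum_distrib_right)
  then have "(\<Sum>j\<in>UNIV. w j * (v j - u)) = 0"
    using sup sum_nonneg[of UNIV "\<lambda>j. w j * (v j - u)"] nonneg by simp
  then have "w j * (v j - u) = 0"
    using sum_nonneg_eq_0_iff[of UNIV "\<lambda>j. w j * (v j - u)"] nonneg by simp
  with j show ?thesis by simp
qed

text \<open>The form of the result is what a permutation needs: for each \<open>p\<close> in
  \<open>D\<close> a \<open>p\<close>-cycle fits into the level set of \<open>h\<close> at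
  \<open>p\<close>, and these sets are disjoint.\<close>

lemma orbit_length_eq_Lcm:
  fixes f :: "real ^ 'n::finite \<Rightarrow> real ^ 'n"
  assumes f: "convex_map f" "mono f" "additively_homogeneous f"
    and S: "periodic_orbit_of_length f S c"
  obtains D and h :: "'n \<Rightarrow> nat" where "finite D" "\<And>p. p \<in> D \<Longrightarrow> 1 \<le> p \<and> p \<le> card {i. h i = p}"
    "c = Lcm D"
proof -
  obtain x where ex: "\<exists>d\<ge>1. (f ^^ d) x = x" and c: "c = (LEAST d. 1 \<le> d \<and> (f ^^ d) x = x)"
    using S by (auto simp: periodic_orbit_of_length_def)
  define X :: "nat \<Rightarrow> 'n \<Rightarrow> real" where "X = (\<lambda>t i. (f ^^ t) x $ i)"
  have per_iff: "(\<forall>t. X (t + d) = X t) \<longleftrightarrow> (f ^^ d) x = x" for d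
  proof
    assume "\<forall>t. X (t + d) = X t"
    then have "X (0 + d) = X 0" by blast
    then show "(f ^^ d) x = x" by (simp add: X_def vec_eq_iff fun_eq_iff)
  qed (simp add: X_def funpow_add)
  have c_X: "c = seq_period X" by (simp add: c seq_period_def per_iff)
  have c1: "1 \<le> c" and fc: "(f ^^ c) x = x"
    using LeastI_ex[of "\<lambda>d. 1 \<le> d \<and> (f ^^ d) x = x"] ex by (auto simp: c)
  \<comment> \<open>\<open>Q k i\<close> is row \<open>i\<close> of the stochastic matrix at time
    \<open>k\<close>.\<close>
  define Q where "Q k i = (SOME a :: real ^ 'n. (\<forall>j. 0 \<le> a $ j) \<and> (\<Sum>j\<in>UNIV. a $ j) = 1
    \<and> (\<forall>y. f ((f ^^ k) x) $ i + (\<Sum>j\<in>UNIV. a $ j * (y $ j - (f ^^ k) x $ j)) \<le> f y $ i))" for k i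
  have Q: "\<And>k i j. 0 \<le> Q k i $ j" "\<And>k i. (\<Sum>j\<in>UNIV. Q k i $ j) = 1"
    "\<And>k i y. f ((f ^^ k) x) $ i + (\<Sum>j\<in>UNIV. Q k i $ j * (y $ j - (f ^^ k) x $ j)) \<le> f y $ i"
    using someI_ex[OF stochastic_subgradient[OF f, of "(f ^^ k) x" i for k i], folded Q_def]
    by blast+
  interpret superharmonic_orbit X c "\<lambda>k i j. 0 < Q k i $ j"
  proof
    show "1 \<le> c" by fact
    show "X (t + c) = X t" for t using per_iff[of c] fc by simp
    show "\<exists>j. 0 < Q k i $ j" for k i
    proof (rule ccontr)
      assume "\<nexists>j. 0 < Q k i $ j"
      then have "Q k i $ j = 0" for j using Q(1)[of k i j] by (metis less_le)
      then show False using Q(2)[of k i] by simp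
    qed
    show "X (k + m) j - X k j = X (Suc k + m) i - X (Suc k) i"
      if min: "\<And>j. 0 < Q k i $ j \<Longrightarrow> X (Suc k + m) i - X (Suc k) i \<le> X (k + m) j - X k j"
      and j: "0 < Q k i $ j" for k m i j
    proof (rule convex_combination_local_min[where w = "\<lambda>j. Q k i $ j" and v = "\<lambda>j. X (k + m) j - X k j"])
      show "(\<Sum>j\<in>UNIV. Q k i $ j * (X (k + m) j - X k j)) \<le> X (Suc k + m) i - X (Suc k) i"
        \<comment> \<open>The subgradient inequality between two orbit points is superharmonicity of
          the increments.\<close>
        using Q(3)[of k i "(f ^^ (k + m)) x"] by (simp add: X_def)
      show "0 \<le> Q k i $ j" for j by (rule Q(1))
      show "(\<Sum>j\<in>UNIV. Q k i $ j) = 1" by (rule Q(2))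
      show "X (Suc k + m) i - X (Suc k) i \<le> X (k + m) j - X k j" if "0 < Q k i $ j" for j
        by (rule min[OF that])
      show "0 < Q k i $ j" by (rule j)
    qed
  qed
  show thesis
  proof (rule that)
    show "finite recurrent_periods" by (rule finite_recurrent_periods)
    show "1 \<le> p \<and> p \<le> card {i. coord_period i = p}" if "p \<in> recurrent_periods" for p
      by (rule recurrent_period_le_card[OF that])
    show "c = Lcm recurrent_periods" using c_X seq_period_eq_Lcm by (rule trans)
  qed
qed

section \<open>Permutations\<close>

text \<open>In the level set of \<open>h\<close> at each \<open>p\<close> in \<open>D\<close>,
  rotate \<open>p\<close> chosen points, enumerated by \<open>e p\<close>, and fix all the
  others.\<close>

lemma exists_perm_of_order_Lcm:
  fixes h :: "'n::finite \<Rightarrow> nat"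
  assumes "finite D" and D: "\<And>p. p \<in> D \<Longrightarrow> 1 \<le> p \<and> p \<le> card {i. h i = p}"
  obtains \<sigma> :: "'n \<Rightarrow> 'n" where "bij \<sigma>" "\<And>d. \<sigma> ^^ d = id \<longleftrightarrow> Lcm D dvd d"
proof -
  have "\<forall>p. \<exists>e. p \<in> D \<longrightarrow> inj_on e {..<p} \<and> e ` {..<p} \<subseteq> {i. h i = p}"
    using D card_le_inj[of "{..<p}" "{i. h i = p}" for p] by (auto simp: conj_commute)
  then obtain e where e: "\<And>p. p \<in> D \<Longrightarrow> inj_on (e p) {..<p}"
    "\<And>p r. p \<in> D \<Longrightarrow> r < p \<Longrightarrow> h (e p r) = p"
    by (metis (mono_tags, lifting) image_subset_iff lessThan_iff mem_Collect_eq)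
  define \<sigma> where "\<sigma> i = (if h i \<in> D \<and> i \<in> e (h i) ` {..<h i}
    then e (h i) (Suc (inv_into {..<h i} (e (h i)) i) mod h i) else i)" for i
  have step: "\<sigma> (e p r) = e p (Suc r mod p)" if "p \<in> D" "r < p" for p r
    using that e by (simp add: \<sigma>_def inv_into_f_f)
  have pow: "(\<sigma> ^^ d) (e p r) = e p ((r + d) mod p)" if "p \<in> D" "r < p" for p r d
    using that D[of p] by (induction d) (simp_all add: step mod_Suc_eq)
  have fixpt: "(\<sigma> ^^ d) i = i" if "\<not> (h i \<in> D \<and> i \<in> e (h i) ` {..<h i})" for i d
  proof -
    have "\<sigma> i = i" unfolding \<sigma>_def by (rule if_not_P[OF that])
    then show ?thesis by (induction d) simp_all
  qed
  have ord: "\<sigma> ^^ d = id \<longleftrightarrow> Lcm D dvd d" for d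
  proof
    assume id: "\<sigma> ^^ d = id"
    have "p dvd d" if "p \<in> D" for p
    proof -
      have "1 \<le> p" using D that by blast
      then have "e p (d mod p) = e p 0" using pow[OF that, of 0 d] id by simp
      then have "d mod p = 0" using inj_onD[OF e(1)[OF that]] \<open>1 \<le> p\<close> by simp
      then show ?thesis by auto
    qed
    then show "Lcm D dvd d" by (simp add: Lcm_least)
  next
    assume d: "Lcm D dvd d"
    have "(\<sigma> ^^ d) i = i" for i
    proof (cases "h i \<in> D \<and> i \<in> e (h i) ` {..<h i}")
      case True
      then obtain p r where pr: "p \<in> D" "r < p" "i = e p r" by blast
      then have "p dvd d" using d by (meson dvd_Lcm dvd_trans)
      then show ?thesis using pow[OF pr(1,2), of d] pr by (auto elim!: dvdE)
    qed (rule fixpt)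
    then show "\<sigma> ^^ d = id" by auto
  qed
  \<comment> \<open>Bijectivity comes from finite order: the \<open>Lcm\<close> is some
    \<open>Suc m\<close>, and \<open>\<sigma> ^^ m\<close> is the inverse.\<close>
  have "0 \<notin> D" using D by force
  then obtain m where m: "Lcm D = Suc m" using Lcm_0_iff_nat[OF assms(1)] not0_implies_Suc by blast
  have pow_id: "\<sigma> ^^ Suc m = id" using ord[of "Suc m"] m by simp
  have "bij \<sigma>"
  proof (rule o_bij)
    show "(\<sigma> ^^ m) \<circ> \<sigma> = id" using pow_id by (simp only: funpow_Suc_right)
    show "\<sigma> \<circ> (\<sigma> ^^ m) = id" using pow_id by (simp only: funpow.simps)
  qed
  with ord show thesis using that by blast
qed

section \<open>Orders in the symmetric group\<close>

lemma sym_group_pow: "p [^]\<^bsub>sym_group n\<^esub> (d::nat) = p ^^ d"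
  by (induction d) (simp_all add: sym_group_def nat_pow_def funpow_Suc_right del: funpow.simps(2))

text \<open>A natural number is determined by its multiples, so the order can be stated without
  group operations.\<close>

lemma sym_group_ord_eq_iff:
  assumes "p \<in> carrier (sym_group n)"
  shows "group.ord (sym_group n) p = c \<longleftrightarrow> (\<forall>d. p ^^ d = id \<longleftrightarrow> c dvd d)"
proof -
  interpret group "sym_group n" by (rule sym_group_is_group)
  have ord: "p ^^ d = id \<longleftrightarrow> ord p dvd d" for d
    using pow_eq_id[OF assms, of d] by (simp add: sym_group_pow) (simp add: sym_group_def)
  then show ?thesis by (metis dvd_antisym dvd_refl)
qed

lemma funpow_conjugate:
  assumes "\<And>i. g (\<sigma> i) = p (g i)"
  shows "g ((\<sigma> ^^ d) i) = (p ^^ d) (g i)"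
  by (induction d) (simp_all add: assms)

text \<open>The group acts on \<open>{1..n}\<close>, the coordinates are indexed by a type;
  conjugation with an enumeration \<open>g\<close> preserves which powers are trivial.\<close>

lemma sym_group_ord_iff_bij:
  "(\<exists>p \<in> carrier (sym_group CARD('n::finite)). group.ord (sym_group CARD('n)) p = c)
    \<longleftrightarrow> (\<exists>\<sigma>::'n \<Rightarrow> 'n. bij \<sigma> \<and> (\<forall>d. \<sigma> ^^ d = id \<longleftrightarrow> c dvd d))"
proof -
  let ?n = "CARD('n)"
  obtain g :: "'n \<Rightarrow> nat" where g: "bij_betw g UNIV {1..?n}"
    using finite_same_card_bij[of "UNIV :: 'n set" "{1..?n}"] by auto
  have inj: "g i = g j \<longleftrightarrow> i = j" for i j using g by (auto simp: bij_betw_def inj_def)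
  have surj: "x \<in> {1..?n} \<longleftrightarrow> (\<exists>i. x = g i)" for x using g by (auto simp: bij_betw_def)
  have transfer: "p ^^ d = id \<longleftrightarrow> \<sigma> ^^ d = id"
    if p: "p permutes {1..?n}" and conj: "\<And>i. g (\<sigma> i) = p (g i)" for p \<sigma> d
  proof -
    have "(p ^^ d) x = x" if "x \<notin> {1..?n}" for x
      using that p by (induction d) (auto simp: permutes_def)
    then have "p ^^ d = id \<longleftrightarrow> (\<forall>i. (p ^^ d) (g i) = g i)"
      unfolding fun_eq_iff id_apply using surj by metis
    also have "\<dots> \<longleftrightarrow> (\<forall>i. (\<sigma> ^^ d) i = i)"
      by (simp add: funpow_conjugate[of g \<sigma> p, OF conj, symmetric] inj)
    finally show ?thesis by (simp add: fun_eq_iff)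
  qed
  show ?thesis
  proof
    assume "\<exists>p \<in> carrier (sym_group ?n). group.ord (sym_group ?n) p = c"
    then obtain p where p: "p permutes {1..?n}" and c: "\<And>d. p ^^ d = id \<longleftrightarrow> c dvd d"
      using sym_group_ord_eq_iff[of _ ?n c] by (auto simp: sym_group_carrier)
    have "\<forall>i. \<exists>j. g j = p (g i)" using permutes_in_image[OF p] surj by metis
    then obtain \<sigma> where conj: "\<And>i. g (\<sigma> i) = p (g i)" by metis
    have "inj \<sigma>" using conj inj permutes_inj[OF p] by (metis injD injI)
    then have "bij \<sigma>" by (simp add: bij_def finite_UNIV_inj_surj)
    then show "\<exists>\<sigma>::'n \<Rightarrow> 'n. bij \<sigma> \<and> (\<forall>d. \<sigma> ^^ d = id \<longleftrightarrow> c dvd d)"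
      using transfer[OF p conj] c by blast
  next
    assume "\<exists>\<sigma>::'n \<Rightarrow> 'n. bij \<sigma> \<and> (\<forall>d. \<sigma> ^^ d = id \<longleftrightarrow> c dvd d)"
    then obtain \<sigma> :: "'n \<Rightarrow> 'n" where bij: "bij \<sigma>" and c: "\<And>d. \<sigma> ^^ d = id \<longleftrightarrow> c dvd d" by blast
    define p where "p x = (if x \<in> {1..?n} then g (\<sigma> (inv_into UNIV g x)) else x)" for x
    have conj: "g (\<sigma> i) = p (g i)" for i
      using surj[of "g i"] by (auto simp: p_def inv_into_f_f inj_on_def inj)
    have "bij_betw (g \<circ> \<sigma> \<circ> inv_into UNIV g) {1..?n} {1..?n}"
      using bij_betw_trans[OF bij_betw_inv_into[OF g] bij_betw_trans[OF bij g]] by (simp add: comp_assoc)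
    then have "bij_betw p {1..?n} {1..?n}"
      by (rule bij_betw_cong[THEN iffD1, rotated]) (simp add: p_def)
    then have p: "p permutes {1..?n}" by (rule bij_imp_permutes) (auto simp: p_def)
    then have "p \<in> carrier (sym_group ?n)" by (simp add: sym_group_carrier)
    moreover have "group.ord (sym_group ?n) p = c"
      by (subst sym_group_ord_eq_iff[OF calculation]) (simp add: transfer[OF p conj] c)
    ultimately show "\<exists>p \<in> carrier (sym_group ?n). group.ord (sym_group ?n) p = c" by blast
  qed
qed

section \<open>Realizing orders by coordinate permutations\<close>

definition permute_coords :: "('n::finite \<Rightarrow> 'n) \<Rightarrow> real ^ 'n \<Rightarrow> real ^ 'n" where
  "permute_coords \<sigma> x = (\<chi> i. x $ \<sigma> i)"

lemma permute_coords_properties: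
  "convex_map (permute_coords \<sigma>)" "mono (permute_coords \<sigma>)" "additively_homogeneous (permute_coords \<sigma>)"
  by (auto simp: convex_map_def permute_coords_def convex_on_def mono_def less_eq_vec_def
      additively_homogeneous_def vec_eq_iff)

lemma permute_coords_funpow: "(permute_coords \<sigma> ^^ d) x = (\<chi> i. x $ (\<sigma> ^^ d) i)"
  by (induction d)
    (simp_all add: permute_coords_def vec_eq_iff funpow_swap1)

lemma permute_coords_orbit_length:
  fixes \<sigma> :: "'n::finite \<Rightarrow> 'n"
  assumes "1 \<le> c" "\<And>d. \<sigma> ^^ d = id \<longleftrightarrow> c dvd d"
  shows "\<exists>S. periodic_orbit_of_length (permute_coords \<sigma>) S c"
proof -
  obtain g :: "'n \<Rightarrow> nat" where "inj g" using finite_imp_inj_to_nat_seg[of "UNIV :: 'n set"] by auto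
  \<comment> \<open>A point with pairwise distinct entries is fixed only by the trivial permutation,
    so its orbit has the full length \<open>c\<close>.\<close>
  define x :: "real ^ 'n" where "x = (\<chi> i. real (g i))"
  have fixed: "(permute_coords \<sigma> ^^ d) x = x \<longleftrightarrow> c dvd d" for d
    using inj_eq[OF \<open>inj g\<close>] by (simp add: permute_coords_funpow x_def vec_eq_iff assms(2)[symmetric] fun_eq_iff)
  have "c = (LEAST d. 1 \<le> d \<and> (permute_coords \<sigma> ^^ d) x = x)"
    by (rule Least_equality[symmetric]) (use assms(1) in \<open>auto simp: fixed dvd_imp_le\<close>)
  moreover have "\<exists>d\<ge>1. (permute_coords \<sigma> ^^ d) x = x"
    by (rule exI[of _ c]) (simp add: fixed assms(1) del: One_nat_def)
  ultimately have "periodic_orbit_of_length (permute_coords \<sigma>)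
      {(permute_coords \<sigma> ^^ k) x | k. True} c"
    unfolding periodic_orbit_of_length_def by (intro exI[of _ x] conjI refl)
  then show ?thesis ..
qed

theorem corollary5p6:
  fixes c :: nat
  assumes "c \<ge> 1"
  shows "(\<exists>f :: real ^ 'n::finite \<Rightarrow> real ^ 'n.
            convex_map f \<and> mono f \<and> additively_homogeneous f \<and>
            (\<exists>S. periodic_orbit_of_length f S c))
     \<longleftrightarrow> (\<exists>p \<in> carrier (sym_group CARD('n)). group.ord (sym_group CARD('n)) p = c)"
proof -
  \<comment> \<open>Bijections of the index type mediate between orbits and group elements.\<close>
  have "(\<exists>f :: real ^ 'n \<Rightarrow> real ^ 'n. convex_map f \<and> mono f \<and> additively_homogeneous f \<and>
            (\<exists>S. periodic_orbit_of_length f S c))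
     \<longleftrightarrow> (\<exists>\<sigma>::'n \<Rightarrow> 'n. bij \<sigma> \<and> (\<forall>d. \<sigma> ^^ d = id \<longleftrightarrow> c dvd d))" (is "?L \<longleftrightarrow> ?R")
  proof
    assume ?L
    then obtain f :: "real ^ 'n \<Rightarrow> real ^ 'n" and S where f: "convex_map f" "mono f"
      "additively_homogeneous f" "periodic_orbit_of_length f S c" by blast
    obtain D and h :: "'n \<Rightarrow> nat" where D: "finite D"
      "\<And>p. p \<in> D \<Longrightarrow> 1 \<le> p \<and> p \<le> card {i. h i = p}" "c = Lcm D"
      using orbit_length_eq_Lcm[OF f] by metis
    obtain \<sigma> :: "'n \<Rightarrow> 'n" where "bij \<sigma>" "\<And>d. \<sigma> ^^ d = id \<longleftrightarrow> Lcm D dvd d"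
      using exists_perm_of_order_Lcm[OF D(1,2)] by blast
    then show ?R using D(3) by blast
  next
    assume ?R
    then obtain \<sigma> :: "'n \<Rightarrow> 'n" where "\<And>d. \<sigma> ^^ d = id \<longleftrightarrow> c dvd d" by blast
    then have "\<exists>S. periodic_orbit_of_length (permute_coords \<sigma>) S c"
      by (rule permute_coords_orbit_length[OF assms])
    then show ?L
      by (intro exI[of _ "permute_coords \<sigma>"] conjI permute_coords_properties)
  qed
  then show ?thesis by (simp only: sym_group_ord_iff_bij)
qed

end
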